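(* Let $X$ be a finite-dimensional Euclidean space, let $n,h\ge 1$ be integers, let $\mathcal N=\{1,\dots,n\}$, $\mathcal H=\{0,\dots,h-1\}$, and let $\mathcal K(X)$ be the set of nonempty compact subsets of $X$. Let $\sigma:\mathcal K(X)\to\mathcal S$ be continuous with respect to the Hausdorff metric and such that: (1) for all $S\in\mathcal K(X)$, $S\subseteq\sigma(S)$, with equality if $S$ is a singleton; (2) $\sigma(\sigma(S))=\sigma(S)$ for all $S\in\mathcal K(X)$; (3) $S'\subseteq S$ implies $\sigma(S')\subseteq\sigma(S)$ for all $S,S'\in\mathcal K(X)$. For every $k\in\mathcal N$ and every directed graph with delays $\mathcal A$, let $e_k(\mathcal A):X^{hn}\rightrightarrows X$ be a continuous set-valued map with nonempty compact values such that, for every $\tilde x=(x_{i,j})_{i\in\mathcal N,j\in\mathcal H}\in X^{hn}$ (writing $x_k=x_{k,0}$): (i) $e_k(\mathcal A)(\tilde x)=\{x_k\}$ if $\{x_{i,j} : ((i,j),k)\in\mathcal A\}\subseteq\{x_k\}$ (in particular if no arc of $\mathcal A$ ends at $k$); (ii) $e_k(\mathcal A)(\tilde x)\subset \mathrm{ri}\,\sigma\big(\{x_k\}\cup\{x_{i,j} : ((i,j),k)\in\mathcal A\}\big)$ (strict inclusion) otherwise. Let $(\mathcal A(t))_{t\in\mathbb N}$ be a sequence of directed graphs with delays, and consider the system $$x_k(t+1)\in e_k(\mathcal A(t))(\tilde x(t)),\qquad k\in\mathcal N,\ t\in\mathbb N,$$ where $\tilde x(t)\in X^{hn}$ has components $x_{k,j}(t)=x_k(t-j)$.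 Then this system, regarded as a difference inclusion with state $\tilde x(t)\in X^{hn}$, is uniformly bounded and uniformly stable with respect to the collection of equilibrium solutions $x_1(t)\equiv\dots\equiv x_n(t)\equiv\text{constant}$.
   Context: Sets. $\mathcal S$ denotes the set of nonempty compact sets $S\subset X$ for which there is a bijection $\varphi:X\to X$ with $\varphi$ and $\varphi^{-1}$ Lipschitz and $\varphi(S)$ convex. For $S\in\mathcal S$ with such a $\varphi$, $\mathrm{ri}(S)=\varphi^{-1}(\mathrm{ri}(\varphi(S)))$, where $\mathrm{ri}$ of a convex set is its interior in its affine hull; this does not depend on $\varphi$ (by convention, $\mathrm{ri}(S)=\emptyset$ if $S$ is a singleton). Graphs. A directed graph with delays is a subset $\mathcal A\subseteq(\mathcal N\times\mathcal H)\times\mathcal N$ with $((k,0),k)\notin\mathcal A$ for all $k\in\mathcal N$; an element $((k,j),l)\in\mathcal A$ is called an arc from $k$ to $l$. State-space form. The system is viewed as the difference inclusion on $\mathcal X=X^{hn}$ in which, given $\tilde x(t)$, one has $x_{k,0}(t+1)\in e_k(\mathcal A(t))(\tilde x(t))$ and $x_{k,j}(t+1)=x_{k,j-1}(t)$ for $1\le j\le h-1$. Solutions may start at any $t_0\in\mathbb N$ from any $\tilde x(t_0)\in X^{hn}$. The set of equilibrium points corresponding to the considered collection of equilibrium solutions is $\Phi=\{\tilde x\in X^{hn}:\text{all } hn \text{ components } x_{k,j}\text{ are equal}\}$. Stability notions for a difference inclusion $x(t+1)\in e(t,x(t))$ on a Euclidean space $\mathcal X$, with respect to a collection of equilibrium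 solutions with set of equilibrium points $\Phi$. Uniformly stable: for each $\varphi\in\Phi$ and all $c_2>0$ there is $c_1>0$ such that for all $t_0\in\mathbb N$ every solution $\zeta$ satisfies: if $|\zeta(t_0)-\varphi|<c_1$ then $|\zeta(t)-\varphi|<c_2$ for all $t\ge t_0$. Uniformly bounded: for each $\varphi\in\Phi$ and all $c_1>0$ there is $c_2>0$ such that for all $t_0\in\mathbb N$ every solution $\zeta$ satisfies: if $|\zeta(t_0)-\varphi|<c_1$ then $|\zeta(t)-\varphi|<c_2$ for all $t\ge t_0$. *)

theory Defs
  imports "HOL-Analysis.Analysis"
begin

section \<open>Hausdorff metric\<close>

definition nonempty_compacts :: "'a::metric_space set set" where
  "nonempty_compacts = {S. S \<noteq> {} \<and> compact S}"

definition hausdist :: "'a::metric_space set \<Rightarrow> 'a set \<Rightarrow> real" where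
  "hausdist S T = max (SUP x\<in>S. infdist x T) (SUP y\<in>T. infdist y S)"

definition hausdorff_continuous :: "('a::metric_space set \<Rightarrow> 'b::metric_space set) \<Rightarrow> bool" where
  "hausdorff_continuous \<sigma> \<longleftrightarrow>
    (\<forall>S\<in>nonempty_compacts. \<forall>\<epsilon>>0. \<exists>\<delta>>0. \<forall>S'\<in>nonempty_compacts.
       hausdist S' S < \<delta> \<longrightarrow> hausdist (\<sigma> S') (\<sigma> S) < \<epsilon>)"


section \<open>Sets that are convex up to a bi-Lipschitz change of coordinates\<close>

definition straightening :: "('a::euclidean_space \<Rightarrow> 'a) \<Rightarrow> 'a set \<Rightarrow> bool" where
  "straightening \<phi> S \<longleftrightarrow> bij \<phi> \<and> (\<exists>L. L-lipschitz_on UNIV \<phi>) \<and> (\<exists>L. L-lipschitz_on UNIV (inv \<phi>))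
     \<and> convex (\<phi> ` S)"

definition lipschitz_convex_sets :: "'a::euclidean_space set set" where
  "lipschitz_convex_sets = {S. S \<noteq> {} \<and> compact S \<and> (\<exists>\<phi>. straightening \<phi> S)}"

text \<open>The library's \<^const>\<open>rel_interior\<close> of a singleton is that singleton; here it is empty
  by convention. Lemma \<open>ri_eq\<close> shows that the choice of the map is irrelevant.\<close>

definition ri :: "'a::euclidean_space set \<Rightarrow> 'a set" where
  "ri S = (if is_singleton S then {}
           else let \<phi> = (SOME \<phi>. straightening \<phi> S) in \<phi> -` rel_interior (\<phi> ` S))"

lemma straightening_rel_interior_mono:
  assumes "straightening \<phi> S" "straightening \<psi> S"
  shows "\<phi> -` rel_interior (\<phi> ` S) \<subseteq> \<psi> -` rel_interior (\<psi> ` S)"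
proof -
  define g where "g = \<psi> \<circ> inv \<phi>"
  have bij: "bij \<phi>" "bij \<psi>" and conv: "convex (\<phi> ` S)" "convex (\<psi> ` S)"
    and cont: "continuous_on UNIV \<phi>" "continuous_on UNIV (inv \<phi>)"
      "continuous_on UNIV \<psi>" "continuous_on UNIV (inv \<psi>)"
    using assms by (auto simp: straightening_def intro: lipschitz_on_continuous_on)
  have g\<phi>: "g (\<phi> x) = \<psi> x" for x
    using bij by (simp add: g_def bij_is_inj)
  have g_image: "g ` \<phi> ` S = \<psi> ` S"
    by (simp only: image_image g\<phi>)
  have contg: "continuous_on A g" "continuous_on A (\<phi> \<circ> inv \<psi>)" for A
    unfolding g_def using cont
    by (meson continuous_on_compose continuous_on_subset subset_UNIV)+
  have "(\<phi> \<circ> inv \<psi>) (\<psi> x) = \<phi> x" for x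
    using bij by (simp add: bij_is_inj)
  then have "homeomorphism (\<phi> ` S) (\<psi> ` S) g (\<phi> \<circ> inv \<psi>)"
    using contg by (auto simp: homeomorphism_def image_image g\<phi> simp del: o_apply)
  then have "aff_dim (\<phi> ` S) = aff_dim (\<psi> ` S)"
    using homeomorphic_convex_sets[OF conv] homeomorphic_def by blast
  moreover have "inj_on g (\<phi> ` S)"
    unfolding g_def
    using bij by (meson bij_betw_def bij_comp bij_imp_bij_inv inj_on_subset subset_UNIV)
  ultimately have "g ` rel_interior (\<phi> ` S) \<subseteq> rel_interior (\<psi> ` S)"
    using continuous_image_subset_rel_interior[of "\<phi> ` S" g "\<psi> ` S"] g_image contg(1) by auto
  then show ?thesis
    using g\<phi> by fastforce
qed

lemma ri_eq:
  assumes "straightening \<phi> S" "\<not> is_singleton S"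
  shows "ri S = \<phi> -` rel_interior (\<phi> ` S)"
proof -
  define \<psi> where "\<psi> = (SOME \<phi>. straightening \<phi> S)"
  have "straightening \<psi> S"
    unfolding \<psi>_def using assms(1) by (rule someI[of "\<lambda>\<phi>. straightening \<phi> S"])
  then have "\<psi> -` rel_interior (\<psi> ` S) = \<phi> -` rel_interior (\<phi> ` S)"
    using assms(1) by (intro equalityI straightening_rel_interior_mono)
  then show ?thesis
    using assms(2) by (simp add: ri_def Let_def \<psi>_def)
qed


section \<open>Stability of difference inclusions\<close>

text \<open>The state space is a set \<open>X\<close> with distance \<open>d\<close>; the inclusion is
  \<open>x(t + 1) \<in> f t (x(t))\<close>, and a solution starting at time \<open>t\<^sub>0\<close> is only constrained from
  \<open>t\<^sub>0\<close> on.\<close>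

definition solution_from ::
    "'s set \<Rightarrow> (nat \<Rightarrow> 's \<Rightarrow> 's set) \<Rightarrow> nat \<Rightarrow> (nat \<Rightarrow> 's) \<Rightarrow> bool" where
  "solution_from X f t\<^sub>0 \<zeta> \<longleftrightarrow> (\<forall>t\<ge>t\<^sub>0. \<zeta> t \<in> X \<and> \<zeta> (Suc t) \<in> f t (\<zeta> t))"

definition uniformly_stable ::
    "'s set \<Rightarrow> ('s \<Rightarrow> 's \<Rightarrow> real) \<Rightarrow> (nat \<Rightarrow> 's \<Rightarrow> 's set) \<Rightarrow> 's set \<Rightarrow> bool" where
  "uniformly_stable X d f \<Phi> \<longleftrightarrow>
    (\<forall>\<phi>\<in>\<Phi>. \<forall>c\<^sub>2>0. \<exists>c\<^sub>1>0. \<forall>t\<^sub>0 \<zeta>. solution_from X f t\<^sub>0 \<zeta> \<longrightarrow>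
       d (\<zeta> t\<^sub>0) \<phi> < c\<^sub>1 \<longrightarrow> (\<forall>t\<ge>t\<^sub>0. d (\<zeta> t) \<phi> < c\<^sub>2))"

definition uniformly_bounded ::
    "'s set \<Rightarrow> ('s \<Rightarrow> 's \<Rightarrow> real) \<Rightarrow> (nat \<Rightarrow> 's \<Rightarrow> 's set) \<Rightarrow> 's set \<Rightarrow> bool" where
  "uniformly_bounded X d f \<Phi> \<longleftrightarrow>
    (\<forall>\<phi>\<in>\<Phi>. \<forall>c\<^sub>1>0. \<exists>c\<^sub>2>0. \<forall>t\<^sub>0 \<zeta>. solution_from X f t\<^sub>0 \<zeta> \<longrightarrow>
       d (\<zeta> t\<^sub>0) \<phi> < c\<^sub>1 \<longrightarrow> (\<forall>t\<ge>t\<^sub>0. d (\<zeta> t) \<phi> < c\<^sub>2))"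


section \<open>Multi-agent systems with delays\<close>

definition agents :: "nat \<Rightarrow> nat set" where
  "agents n = {1..n}"

definition delays :: "nat \<Rightarrow> nat set" where
  "delays h = {0..<h}"

type_synonym delay_graph = "((nat \<times> nat) \<times> nat) set"

definition is_delay_graph :: "nat \<Rightarrow> nat \<Rightarrow> delay_graph \<Rightarrow> bool" where
  "is_delay_graph n h \<A> \<longleftrightarrow>
    \<A> \<subseteq> (agents n \<times> delays h) \<times> agents n \<and> (\<forall>k\<in>agents n. ((k, 0), k) \<notin> \<A>)"

text \<open>The space \<open>X\<^bsup>hn\<^esup>\<close> with its Euclidean distance and topology, as the extensional functions on
  the index set.\<close>

type_synonym 'a state = "nat \<times> nat \<Rightarrow> 'a"

definition state_space :: "nat \<Rightarrow> nat \<Rightarrow> 'a state set" where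
  "state_space n h = (agents n \<times> delays h) \<rightarrow>\<^sub>E UNIV"

definition state_dist :: "nat \<Rightarrow> nat \<Rightarrow> 'a::real_normed_vector state \<Rightarrow> 'a state \<Rightarrow> real" where
  "state_dist n h x y = L2_set (\<lambda>p. norm (x p - y p)) (agents n \<times> delays h)"

definition state_topology :: "nat \<Rightarrow> nat \<Rightarrow> 'a::topological_space state topology" where
  "state_topology n h = product_topology (\<lambda>_. euclidean) (agents n \<times> delays h)"

lemma topspace_state_topology: "topspace (state_topology n h) = state_space n h"
  by (simp add: state_topology_def state_space_def)

text \<open>Continuity of a set-valued map: upper and lower semicontinuity. For nonempty compact values
  in a metric space this is continuity with respect to the Hausdorff metric.\<close>

definition set_valued_continuous ::
    "'s topology \<Rightarrow> ('s \<Rightarrow> 'a::topological_space set) \<Rightarrow> bool" where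
  "set_valued_continuous T F \<longleftrightarrow>
    (\<forall>U. open U \<longrightarrow> openin T {x \<in> topspace T. F x \<subseteq> U}
                 \<and> openin T {x \<in> topspace T. F x \<inter> U \<noteq> {}})"

definition neighbour_values :: "delay_graph \<Rightarrow> nat \<Rightarrow> 'a state \<Rightarrow> 'a set" where
  "neighbour_values \<A> k x = {x (i, j) | i j. ((i, j), k) \<in> \<A>}"

definition system_inclusion ::
    "nat \<Rightarrow> nat \<Rightarrow> (nat \<Rightarrow> delay_graph \<Rightarrow> 'a state \<Rightarrow> 'a set) \<Rightarrow> (nat \<Rightarrow> delay_graph)
      \<Rightarrow> nat \<Rightarrow> 'a state \<Rightarrow> 'a state set" where
  "system_inclusion n h e \<A> t x =
    {y \<in> state_space n h. \<forall>k\<in>agents n.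
       y (k, 0) \<in> e k (\<A> t) x \<and> (\<forall>j\<in>{1..h - 1}. y (k, j) = x (k, j - 1))}"

definition consensus_states :: "nat \<Rightarrow> nat \<Rightarrow> 'a state set" where
  "consensus_states n h =
    {x \<in> state_space n h. \<forall>p\<in>agents n \<times> delays h. \<forall>q\<in>agents n \<times> delays h. x p = x q}"

end

theory Submission
  imports Defs
begin

text \<open>
  For a nonempty compact set \<open>K\<close>, the set \<open>\<sigma> K\<close> is forward invariant: if every component of the
  state, delayed or not, lies in \<open>\<sigma> K\<close>, then so does every new component, because it belongs to
  \<open>\<sigma> C\<close> for a finite set \<open>C \<subseteq> \<sigma> K\<close> of old components, and \<open>\<sigma> C \<subseteq> \<sigma> (\<sigma> K) = \<sigma> K\<close> by
  monotonicity and idempotence (lemma \<open>components_remain_in_hull\<close>).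

  A solution that starts within distance \<open>r\<close> of the consensus state with value \<open>p\<close> has all its
  components in \<open>cball p r \<subseteq> \<sigma> (cball p r)\<close>, so they never leave \<open>\<sigma> (cball p r)\<close>. Both stability
  properties are thereby reduced to the size of this one set (lemma \<open>state_dist_bound\<close>), uniformly in
  the initial time. It is compact, which gives uniform boundedness. It shrinks to \<open>\<sigma> {p} = {p}\<close> as
  \<open>r\<close> tends to \<open>0\<close>, by continuity of \<open>\<sigma>\<close> in the Hausdorff metric (lemma
  \<open>hull_of_small_ball_is_small\<close>), which gives uniform stability.
\<close>

lemma ri_subset:
  assumes "S \<in> lipschitz_convex_sets"
  shows "ri S \<subseteq> S"
proof (cases "is_singleton S")
  case True
  then show ?thesis by (simp add: ri_def)
next
  case False
  obtain \<phi> where \<phi>: "straightening \<phi> S"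
    using assms by (auto simp: lipschitz_convex_sets_def)
  have "\<phi> -` rel_interior (\<phi> ` S) \<subseteq> \<phi> -` (\<phi> ` S)"
    by (intro vimage_mono rel_interior_subset)
  also have "\<dots> = S"
    using \<phi> by (simp add: straightening_def bij_is_inj inj_vimage_image_eq)
  finally show ?thesis
    using ri_eq[OF \<phi> False] by simp
qed

lemma hausdist_cball_singleton_le:
  fixes p :: "'a::metric_space"
  assumes "r \<ge> 0"
  shows "hausdist (cball p r) {p} \<le> r"
proof -
  have "(SUP x\<in>cball p r. infdist x {p}) \<le> r"
    using assms by (intro cSUP_least) (auto simp: dist_commute)
  moreover have "(SUP y\<in>{p}. infdist y (cball p r)) \<le> r"
    using assms by simp
  ultimately show ?thesis
    by (simp add: hausdist_def)
qed

lemma infdist_le_hausdist: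
  assumes "compact S" "x \<in> S"
  shows "infdist x T \<le> hausdist S T"
proof -
  have "compact ((\<lambda>x. infdist x T) ` S)"
    using assms(1) by (intro compact_continuous_image continuous_intros)
  \<comment> \<open>Compactness makes the supremum bounded, so that it is an upper bound.\<close>
  then have "bdd_above ((\<lambda>x. infdist x T) ` S)"
    by (intro bounded_imp_bdd_above compact_imp_bounded)
  then have "infdist x T \<le> (SUP x\<in>S. infdist x T)"
    using assms(2) by (intro cSUP_upper)
  then show ?thesis
    by (simp add: hausdist_def)
qed

text \<open>A small ball is close to its centre in the Hausdorff metric, so continuity of \<open>\<sigma>\<close> at \<open>{p}\<close>
  puts its image close to \<open>{q}\<close>.\<close>

lemma hull_of_small_ball_is_small:
  fixes \<sigma> :: "'a::heine_borel set \<Rightarrow> 'b::metric_space set"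
  assumes "hausdorff_continuous \<sigma>"
    and compact: "\<And>S. S \<in> nonempty_compacts \<Longrightarrow> compact (\<sigma> S)"
    and "\<sigma> {p} = {q}" and "\<epsilon> > 0"
  shows "\<exists>r>0. \<sigma> (cball p r) \<subseteq> cball q \<epsilon>"
proof -
  have "{p} \<in> nonempty_compacts"
    by (simp add: nonempty_compacts_def)
  then obtain \<delta> where \<delta>: "\<delta> > 0"
    "\<And>S. S \<in> nonempty_compacts \<Longrightarrow> hausdist S {p} < \<delta> \<Longrightarrow> hausdist (\<sigma> S) (\<sigma> {p}) < \<epsilon>"
    using assms(1) \<open>\<epsilon> > 0\<close> unfolding hausdorff_continuous_def by meson
  have ball: "cball p (\<delta> / 2) \<in> nonempty_compacts"
    using \<delta>(1) by (auto simp: nonempty_compacts_def)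
  have "hausdist (cball p (\<delta> / 2)) {p} < \<delta>"
    using hausdist_cball_singleton_le[of "\<delta> / 2" p] \<delta>(1) by linarith
  then have close: "hausdist (\<sigma> (cball p (\<delta> / 2))) {q} < \<epsilon>"
    using \<delta>(2)[OF ball] \<open>\<sigma> {p} = {q}\<close> by simp
  have "\<sigma> (cball p (\<delta> / 2)) \<subseteq> cball q \<epsilon>"
  proof
    fix x assume "x \<in> \<sigma> (cball p (\<delta> / 2))"
    then have "infdist x {q} < \<epsilon>"
      using infdist_le_hausdist[OF compact[OF ball]] close by (meson order_le_less_trans)
    then show "x \<in> cball q \<epsilon>"
      by (simp add: dist_commute)
  qed
  then show ?thesis
    using \<delta>(1) by (intro exI[of _ "\<delta> / 2"]) simp
qed

lemma norm_component_le_state_dist: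
  assumes "p \<in> agents n \<times> delays h"
  shows "norm (x p - y p) \<le> state_dist n h x y"
  unfolding state_dist_def using assms
  by (intro member_le_L2_set) (auto simp: agents_def delays_def)

lemma state_dist_le:
  assumes "\<And>p. p \<in> agents n \<times> delays h \<Longrightarrow> norm (x p - y p) \<le> R"
  shows "state_dist n h x y \<le> real (n * h) * R"
proof -
  have "state_dist n h x y \<le> (\<Sum>p\<in>agents n \<times> delays h. norm (x p - y p))"
    unfolding state_dist_def by (rule L2_set_le_sum) simp
  also have "\<dots> \<le> real (card (agents n \<times> delays h)) * R"
    using assms by (rule sum_bounded_above)
  finally show ?thesis
    by (simp add: agents_def delays_def card_cartesian_product)
qed

lemma finite_neighbour_values:
  assumes "is_delay_graph n h G"
  shows "finite (neighbour_values G k x)"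
proof -
  have "neighbour_values G k x \<subseteq> x ` (agents n \<times> delays h)"
    using assms by (auto simp: neighbour_values_def is_delay_graph_def)
  then show ?thesis
    by (rule finite_subset) (simp add: agents_def delays_def)
qed

text \<open>Each update lies in the hull of some finite set of current components, hence in
  \<open>\<sigma> (\<sigma> K) = \<sigma> K\<close>; a delayed component is a copy of one from the preceding step. Having \<open>\<sigma> K\<close> in
  place of \<open>K\<close> in the initial condition makes the claim its own induction hypothesis.\<close>

lemma components_remain_in_hull:
  fixes \<sigma> :: "'a::metric_space set \<Rightarrow> 'a set"
  assumes hull: "\<And>S. S \<in> nonempty_compacts \<Longrightarrow> \<sigma> S \<in> nonempty_compacts"
    and idem: "\<And>S. S \<in> nonempty_compacts \<Longrightarrow> \<sigma> (\<sigma> S) = \<sigma> S"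
    and mono: "\<And>S S'. S \<in> nonempty_compacts \<Longrightarrow> S' \<in> nonempty_compacts \<Longrightarrow> S' \<subseteq> S \<Longrightarrow>
      \<sigma> S' \<subseteq> \<sigma> S"
    and update: "\<And>k t x. k \<in> agents n \<Longrightarrow> x \<in> state_space n h \<Longrightarrow>
      e k (\<A> t) x \<subseteq> \<sigma> ({x (k, 0)} \<union> neighbour_values (\<A> t) k x)"
    and graph: "\<And>t. is_delay_graph n h (\<A> t)"
    and K: "K \<in> nonempty_compacts"
    and sol: "solution_from (state_space n h) (system_inclusion n h e \<A>) t\<^sub>0 \<zeta>"
    and start: "\<zeta> t\<^sub>0 ` (agents n \<times> delays h) \<subseteq> \<sigma> K"
    and "t\<^sub>0 \<le> t"
  shows "\<zeta> t ` (agents n \<times> delays h) \<subseteq> \<sigma> K"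
  using \<open>t\<^sub>0 \<le> t\<close>
proof (induction t rule: dec_induct)
  case base
  show ?case by (rule start)
next
  case (step t)
  have state: "\<zeta> t \<in> state_space n h"
    and next_state: "\<zeta> (Suc t) \<in> system_inclusion n h e \<A> t (\<zeta> t)"
    using sol step.hyps by (auto simp: solution_from_def)
  have "\<zeta> (Suc t) (k, j) \<in> \<sigma> K" if k: "k \<in> agents n" and j: "j \<in> delays h" for k j
  proof (cases "j = 0")
    case True
    define C where "C = {\<zeta> t (k, 0)} \<union> neighbour_values (\<A> t) k (\<zeta> t)"
    have "C \<in> nonempty_compacts"
      using finite_neighbour_values[OF graph]
      by (auto simp: C_def nonempty_compacts_def intro: finite_imp_compact)
    moreover have "C \<subseteq> \<zeta> t ` (agents n \<times> delays h)"
      using graph[of t] k j True by (auto simp: C_def neighbour_values_def is_delay_graph_def)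
    with step.IH have "C \<subseteq> \<sigma> K"
      by blast
    ultimately have "\<sigma> C \<subseteq> \<sigma> K"
      using mono[OF hull[OF K]] idem[OF K] by metis
    moreover have "\<zeta> (Suc t) (k, 0) \<in> \<sigma> C"
      using next_state update[OF k state] k unfolding C_def system_inclusion_def by blast
    ultimately show ?thesis
      using True by auto
  next
    case False
    then have "\<zeta> (Suc t) (k, j) = \<zeta> t (k, j - 1)"
      using next_state k j by (auto simp: system_inclusion_def delays_def)
    moreover have "j - 1 \<in> delays h"
      using j by (auto simp: delays_def)
    ultimately show ?thesis
      using step.IH k by auto
  qed
  then show ?case
    by auto
qed

text \<open>The factor \<open>n * h\<close> only compares the Euclidean distance of states with the largest distance
  between components.\<close>

lemma state_dist_bound:
  fixes \<sigma> :: "'a::euclidean_space set \<Rightarrow> 'a set"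
  assumes hull: "\<And>S. S \<in> nonempty_compacts \<Longrightarrow> \<sigma> S \<in> nonempty_compacts"
    and ext: "\<And>S. S \<in> nonempty_compacts \<Longrightarrow> S \<subseteq> \<sigma> S"
    and idem: "\<And>S. S \<in> nonempty_compacts \<Longrightarrow> \<sigma> (\<sigma> S) = \<sigma> S"
    and mono: "\<And>S S'. S \<in> nonempty_compacts \<Longrightarrow> S' \<in> nonempty_compacts \<Longrightarrow> S' \<subseteq> S \<Longrightarrow>
      \<sigma> S' \<subseteq> \<sigma> S"
    and update: "\<And>k t x. k \<in> agents n \<Longrightarrow> x \<in> state_space n h \<Longrightarrow>
      e k (\<A> t) x \<subseteq> \<sigma> ({x (k, 0)} \<union> neighbour_values (\<A> t) k x)"
    and graph: "\<And>t. is_delay_graph n h (\<A> t)"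
    and consensus: "\<And>i. i \<in> agents n \<times> delays h \<Longrightarrow> \<phi> i = p"
    and "r > 0" and small: "\<sigma> (cball p r) \<subseteq> cball p R"
    and sol: "solution_from (state_space n h) (system_inclusion n h e \<A>) t\<^sub>0 \<zeta>"
    and start: "state_dist n h (\<zeta> t\<^sub>0) \<phi> < r"
    and "t\<^sub>0 \<le> t"
  shows "state_dist n h (\<zeta> t) \<phi> \<le> real (n * h) * R"
proof -
  have ball: "cball p r \<in> nonempty_compacts"
    using \<open>r > 0\<close> by (auto simp: nonempty_compacts_def)
  have "\<zeta> t\<^sub>0 ` (agents n \<times> delays h) \<subseteq> cball p r"
  proof (rule image_subsetI)
    fix i assume i: "i \<in> agents n \<times> delays h"
    show "\<zeta> t\<^sub>0 i \<in> cball p r"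
      using norm_component_le_state_dist[OF i, of "\<zeta> t\<^sub>0" \<phi>] start consensus[OF i]
      by (simp add: dist_norm norm_minus_commute)
  qed
  then have "\<zeta> t\<^sub>0 ` (agents n \<times> delays h) \<subseteq> \<sigma> (cball p r)"
    using ext[OF ball] by blast
  then have inside: "\<zeta> t ` (agents n \<times> delays h) \<subseteq> \<sigma> (cball p r)"
    using components_remain_in_hull[OF hull idem mono update graph ball sol _ \<open>t\<^sub>0 \<le> t\<close>]
    by blast
  show ?thesis
  proof (rule state_dist_le)
    fix i assume i: "i \<in> agents n \<times> delays h"
    then have "\<zeta> t i \<in> cball p R"
      using inside small by blast
    then show "norm (\<zeta> t i - \<phi> i) \<le> R"
      using consensus[OF i] by (simp add: dist_norm norm_minus_commute)
  qed
qed

theorem theorem1: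
  fixes n h :: nat
    and \<sigma> :: "'a::euclidean_space set \<Rightarrow> 'a set"
    and e :: "nat \<Rightarrow> delay_graph \<Rightarrow> 'a state \<Rightarrow> 'a set"
    and \<A> :: "nat \<Rightarrow> delay_graph"
  assumes "n \<ge> 1" and "h \<ge> 1"
    and "\<And>S. S \<in> nonempty_compacts \<Longrightarrow> \<sigma> S \<in> lipschitz_convex_sets"
    and "hausdorff_continuous \<sigma>"
    and "\<And>S. S \<in> nonempty_compacts \<Longrightarrow> S \<subseteq> \<sigma> S"
    and "\<And>S. S \<in> nonempty_compacts \<Longrightarrow> is_singleton S \<Longrightarrow> \<sigma> S = S"
    and "\<And>S. S \<in> nonempty_compacts \<Longrightarrow> \<sigma> (\<sigma> S) = \<sigma> S"
    and "\<And>S S'. S \<in> nonempty_compacts \<Longrightarrow> S' \<in> nonempty_compacts \<Longrightarrow> S' \<subseteq> S \<Longrightarrow> \<sigma> S' \<subseteq> \<sigma> S"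
    and "\<And>k G x. k \<in> agents n \<Longrightarrow> is_delay_graph n h G \<Longrightarrow> x \<in> state_space n h \<Longrightarrow>
           e k G x \<in> nonempty_compacts"
    and "\<And>k G. k \<in> agents n \<Longrightarrow> is_delay_graph n h G \<Longrightarrow>
           set_valued_continuous (state_topology n h) (e k G)"
    and "\<And>k G x. k \<in> agents n \<Longrightarrow> is_delay_graph n h G \<Longrightarrow> x \<in> state_space n h \<Longrightarrow>
           neighbour_values G k x \<subseteq> {x (k, 0)} \<Longrightarrow> e k G x = {x (k, 0)}"
    and "\<And>k G x. k \<in> agents n \<Longrightarrow> is_delay_graph n h G \<Longrightarrow> x \<in> state_space n h \<Longrightarrow>
           \<not> neighbour_values G k x \<subseteq> {x (k, 0)} \<Longrightarrow>
           e k G x \<subset> ri (\<sigma> ({x (k, 0)} \<union> neighbour_values G k x))"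
    and "\<And>t. is_delay_graph n h (\<A> t)"
  shows "uniformly_bounded (state_space n h) (state_dist n h)
           (system_inclusion n h e \<A>) (consensus_states n h)
       \<and> uniformly_stable (state_space n h) (state_dist n h)
           (system_inclusion n h e \<A>) (consensus_states n h)"
proof -
  have hull: "\<sigma> S \<in> nonempty_compacts" if "S \<in> nonempty_compacts" for S
    using assms(3)[OF that] by (simp add: lipschitz_convex_sets_def nonempty_compacts_def)
  have update: "e k (\<A> t) x \<subseteq> \<sigma> ({x (k, 0)} \<union> neighbour_values (\<A> t) k x)" (is "_ \<subseteq> \<sigma> ?C")
    if k: "k \<in> agents n" and x: "x \<in> state_space n h" for k t x
  proof -
    have C: "?C \<in> nonempty_compacts"
      using finite_neighbour_values[OF assms(13)]
      by (auto simp: nonempty_compacts_def intro: finite_imp_compact)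
    show ?thesis
    proof (cases "neighbour_values (\<A> t) k x \<subseteq> {x (k, 0)}")
      case True
      then show ?thesis
        using assms(11)[OF k assms(13) x] assms(5)[OF C] by auto
    next
      case False
      then show ?thesis
        using assms(12)[OF k assms(13) x] ri_subset[OF assms(3)[OF C]] by blast
    qed
  qed
  note bound = state_dist_bound[where \<sigma> = \<sigma> and e = e and \<A> = \<A> and n = n and h = h,
      OF hull assms(5,7,8) update assms(13)]
  have consensus: "\<exists>p. \<forall>i \<in> agents n \<times> delays h. \<phi> i = p" if "\<phi> \<in> consensus_states n h"
    for \<phi> :: "'a state"
    using that unfolding consensus_states_def by blast
  have "\<exists>c\<^sub>2>0. \<forall>t\<^sub>0 \<zeta>. solution_from (state_space n h) (system_inclusion n h e \<A>) t\<^sub>0 \<zeta> \<longrightarrow>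
      state_dist n h (\<zeta> t\<^sub>0) \<phi> < c\<^sub>1 \<longrightarrow> (\<forall>t\<ge>t\<^sub>0. state_dist n h (\<zeta> t) \<phi> < c\<^sub>2)"
    if \<phi>: "\<phi> \<in> consensus_states n h" and pos: "c\<^sub>1 > 0" for \<phi> c\<^sub>1
  proof -
    obtain p where p: "\<And>i. i \<in> agents n \<times> delays h \<Longrightarrow> \<phi> i = p"
      using consensus[OF \<phi>] by blast
    have "cball p c\<^sub>1 \<in> nonempty_compacts"
      using pos by (auto simp: nonempty_compacts_def)
    then have "bounded (\<sigma> (cball p c\<^sub>1))"
      using hull by (auto simp: nonempty_compacts_def intro: compact_imp_bounded)
    then obtain R where R: "\<sigma> (cball p c\<^sub>1) \<subseteq> cball p R"
      unfolding bounded_any_center[where a = p] by (meson mem_cball subsetI)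
    show ?thesis
    proof (intro exI[of _ "\<bar>real (n * h) * R\<bar> + 1"] conjI allI impI)
      fix t\<^sub>0 \<zeta> t
      assume "solution_from (state_space n h) (system_inclusion n h e \<A>) t\<^sub>0 \<zeta>"
        and "state_dist n h (\<zeta> t\<^sub>0) \<phi> < c\<^sub>1" and "t\<^sub>0 \<le> t"
      then have "state_dist n h (\<zeta> t) \<phi> \<le> real (n * h) * R"
        using bound p pos R by blast
      then show "state_dist n h (\<zeta> t) \<phi> < \<bar>real (n * h) * R\<bar> + 1"
        by linarith
    qed simp
  qed
  moreover have "\<exists>c\<^sub>1>0. \<forall>t\<^sub>0 \<zeta>. solution_from (state_space n h) (system_inclusion n h e \<A>) t\<^sub>0 \<zeta> \<longrightarrow>
      state_dist n h (\<zeta> t\<^sub>0) \<phi> < c\<^sub>1 \<longrightarrow> (\<forall>t\<ge>t\<^sub>0. state_dist n h (\<zeta> t) \<phi> < c\<^sub>2)"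
    if \<phi>: "\<phi> \<in> consensus_states n h" and pos: "c\<^sub>2 > 0" for \<phi> c\<^sub>2
  proof -
    obtain p where p: "\<And>i. i \<in> agents n \<times> delays h \<Longrightarrow> \<phi> i = p"
      using consensus[OF \<phi>] by blast
    \<comment> \<open>The denominator makes \<open>n * h\<close> times this radius strictly smaller than \<open>c\<^sub>2\<close>.\<close>
    define R where "R = c\<^sub>2 / (real (n * h) + 1)"
    have "R > 0"
      using pos unfolding R_def by (intro divide_pos_pos add_nonneg_pos) simp_all
    have "R * (real (n * h) + 1) = c\<^sub>2"
      unfolding R_def by (simp add: add_nonneg_eq_0_iff)
    then have R: "real (n * h) * R < c\<^sub>2"
      using \<open>R > 0\<close> by (simp add: algebra_simps)
    have "\<sigma> {p} = {p}"
      by (rule assms(6)) (simp_all add: nonempty_compacts_def)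
    moreover have "compact (\<sigma> S)" if "S \<in> nonempty_compacts" for S
      using hull[OF that] by (simp add: nonempty_compacts_def)
    ultimately obtain r where "r > 0" and small: "\<sigma> (cball p r) \<subseteq> cball p R"
      using hull_of_small_ball_is_small[OF assms(4) _ _ \<open>R > 0\<close>] by blast
    show ?thesis
    proof (intro exI[of _ r] conjI allI impI)
      fix t\<^sub>0 \<zeta> t
      assume "solution_from (state_space n h) (system_inclusion n h e \<A>) t\<^sub>0 \<zeta>"
        and "state_dist n h (\<zeta> t\<^sub>0) \<phi> < r" and "t\<^sub>0 \<le> t"
      then have "state_dist n h (\<zeta> t) \<phi> \<le> real (n * h) * R"
        using bound p \<open>r > 0\<close> small by blast
      then show "state_dist n h (\<zeta> t) \<phi> < c\<^sub>2"
        using R by linarith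
    qed (rule \<open>r > 0\<close>)
  qed
  ultimately show ?thesis
    unfolding uniformly_bounded_def uniformly_stable_def by blast
qed

end
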